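(* For every integer $k>1$, the generalised ant with rule word $L^{2k}R$ (i.e. $2k$ letters $L$ followed by one letter $R$) admits at least two different highways: a fundamental highway of period $16k+2$ and drift $(\pm1,\pm1)$, and a harmonic highway of period $32k+4$ and drift $(\pm2,\pm2)$.
   Context: A generalised ant with rule word $w=w_0w_1\cdots w_{|w|-1}\in\{L,R\}^+$ has state set $Q=\{\rightarrow,\uparrow,\leftarrow,\downarrow\}$ (the four unit vectors of $\mathbb{Z}^2$) and alphabet $A=\{0,1,\dots,|w|-1\}=\mathbb{Z}/|w|\mathbb{Z}$. A configuration is $(C,(i,j),d)\in A^{\mathbb{Z}^2}\times\mathbb{Z}^2\times Q$ (picture, ant position, ant direction). The transition $T_w(C,(i,j),d)=(C',(i',j'),d')$ is: $C'(i,j)=C(i,j)+1 \bmod |w|$ and $C'(k,l)=C(k,l)$ for $(k,l)\neq(i,j)$; $d'$ is $d$ rotated by $90^\circ$ clockwise if $w_{C(i,j)}=R$ and counterclockwise if $w_{C(i,j)}=L$; $(i',j')=(i,j)+d'$. A pattern is a map $P:S\to A$ with $S\subseteq\mathbb{Z}^2$ finite (its support); $T_w$ is applied to $(P,(i,j),d)$ by the same rule, provided $(i,j)\in S$. A highway of period $N$ and drift $(a,b)\in\mathbb{Z}^2$ of the ant $w$ is given by a pattern $P$ with support $S$, a position $(i,j)\in S$ and a direction $d$ such that $T_w$ can be applied $N$ times starting from $(P,(i,j),d)$ (the ant stays in $S$ before each application), the resulting pattern $T_w^N(P)$ has the ant at position $(i,j)+(a,b)$ with direction $d$, and for all $(x,y)\in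 S$: $P(x,y)=T_w^N(P)(x+a,y+b)$ if $(x+a,y+b)\in S$, and $P(x,y)=0$ otherwise. Highways obtained from one another by rotation, translation, or by choosing another pattern along the same periodic evolution are regarded as the same highway; the trace of an ant is the sequence of symbols it reads along its evolution. *)

theory Defs
  imports Main "HOL-Library.Product_Plus"
begin

datatype letter = L | R

type_synonym vec = "int \<times> int"

text \<open>A configuration consists of a picture, the position of the ant and its direction.
  Symbols are natural numbers below the length of the rule word, and directions are unit vectors.\<close>

type_synonym config = "(vec \<Rightarrow> nat) \<times> vec \<times> vec"

definition directions :: "vec set" where
  "directions = {(1, 0), (0, 1), (-1, 0), (0, -1)}"

fun ccw :: "vec \<Rightarrow> vec" where
  "ccw (x, y) = (- y, x)"

fun cw :: "vec \<Rightarrow> vec" where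
  "cw (x, y) = (y, - x)"

fun ant_step :: "letter list \<Rightarrow> config \<Rightarrow> config" where
  "ant_step w (C, p, d) =
    (let d' = (if w ! C p = R then cw d else ccw d)
     in (C(p := (C p + 1) mod length w), p + d', d'))"

abbreviation picture :: "config \<Rightarrow> vec \<Rightarrow> nat" where
  "picture c \<equiv> fst c"

abbreviation position :: "config \<Rightarrow> vec" where
  "position c \<equiv> fst (snd c)"

abbreviation direction :: "config \<Rightarrow> vec" where
  "direction c \<equiv> snd (snd c)"

text \<open>A pattern with support \<open>S\<close> is represented by a total function of which only the values on
  \<open>S\<close> matter. A step changes the picture only at the position of the ant, so the transition on
  patterns is \<open>ant_step\<close>, applicable as long as the ant is in \<open>S\<close>.\<close>

type_synonym highway = "vec set \<times> (vec \<Rightarrow> nat) \<times> vec \<times> vec"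

fun is_highway :: "letter list \<Rightarrow> nat \<Rightarrow> vec \<Rightarrow> highway \<Rightarrow> bool" where
  "is_highway w N v (S, P, p, d) \<longleftrightarrow>
     N > 0 \<and> finite S \<and> (\<forall>z\<in>S. P z < length w) \<and> p \<in> S \<and> d \<in> directions \<and>
     (\<forall>n<N. position ((ant_step w ^^ n) (P, p, d)) \<in> S) \<and>
     position ((ant_step w ^^ N) (P, p, d)) = p + v \<and>
     direction ((ant_step w ^^ N) (P, p, d)) = d \<and>
     (\<forall>z\<in>S. P z = (if z + v \<in> S then picture ((ant_step w ^^ N) (P, p, d)) (z + v) else 0))"

text \<open>The periodic evolution of a highway: outside the support the plane is filled with the symbol
  \<open>0\<close>, so that after \<open>N\<close> steps the ant sees a copy of the pattern translated by the drift, and so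
  on forever.\<close>

fun evolution :: "letter list \<Rightarrow> highway \<Rightarrow> nat \<Rightarrow> config" where
  "evolution w (S, P, p, d) n = (ant_step w ^^ n) ((\<lambda>z. if z \<in> S then P z else 0), p, d)"

definition symbol_read :: "config \<Rightarrow> nat" where
  "symbol_read c = picture c (position c)"

text \<open>Two highways are the same if, each from a suitable time on, their evolutions agree up to a
  rotation (by \<open>r\<close> quarter turns) and a translation (by \<open>u\<close>). Pictures are compared only through
  the symbols the ant reads: patterns along one evolution may differ in cells that are never
  visited again. The period does not occur, so a highway traversed several times over is the
  same highway.\<close>

definition same_highway :: "letter list \<Rightarrow> highway \<Rightarrow> highway \<Rightarrow> bool" where
  "same_highway w H H' \<longleftrightarrow>
     (\<exists>r u s t. \<forall>n.
        let c = evolution w H (s + n); c' = evolution w H' (t + n)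
        in position c' = (ccw ^^ r) (position c) + u \<and>
           direction c' = (ccw ^^ r) (direction c) \<and>
           symbol_read c' = symbol_read c)"

end

theory Submission
  imports Defs
begin

text \<open>The ant turns left until it meets the symbol \<open>2k\<close>, so it mostly circles around \<open>2 \<times> 2\<close>
  blocks. There is a family of patterns indexed by \<open>0 < m < 2k\<close> such that from the \<open>m\<close>-th one
  the ant turns according to \<open>L\<^sup>8\<^sup>k R L\<^sup>4\<^sup>m R L\<^sup>4\<^sup>m\<^sup>-\<^sup>4 R R L R\<close> and thereby reaches the \<open>(2k - m)\<close>-th
  pattern, translated by \<open>(1, 1)\<close>. The fixed point \<open>m = k\<close> is the fundamental highway, and
  alternating \<open>m = k + 1\<close> with \<open>m = k - 1\<close> is a harmonic one. They differ because the harmonic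
  one has two right turns that are \<open>4k + 5\<close> steps apart.\<close>

section \<open>Runs of the ant as words of turns\<close>

text \<open>Turns are recorded instead of symbols: a symbol matters only through whether it equals
  \<open>2k\<close>. \<open>S\<close> carries the support condition of patterns.\<close>

fun run :: "letter list \<Rightarrow> vec set \<Rightarrow> letter list \<Rightarrow> config \<Rightarrow> config \<Rightarrow> bool" where
  "run w S [] c c' \<longleftrightarrow> c' = c"
| "run w S (a # as) c c' \<longleftrightarrow>
     position c \<in> S \<and> w ! symbol_read c = a \<and> run w S as (ant_step w c) c'"

lemma run_append:
  "run w S (as @ bs) c c'' \<longleftrightarrow> (\<exists>c'. run w S as c c' \<and> run w S bs c' c'')"
  by (induction as arbitrary: c) auto

lemma run_mono: "run w S as c c' \<Longrightarrow> S \<subseteq> T \<Longrightarrow> run w T as c c'"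
  by (induction as arbitrary: c) auto

lemma run_funpow: "run w S as c c' \<Longrightarrow> (ant_step w ^^ length as) c = c'"
  by (induction as arbitrary: c) (auto simp: funpow_swap1)

lemma run_nth:
  assumes "run w S as c c'" "i < length as"
  shows "position ((ant_step w ^^ i) c) \<in> S" "w ! symbol_read ((ant_step w ^^ i) c) = as ! i"
proof -
  have "position ((ant_step w ^^ i) c) \<in> S \<and> w ! symbol_read ((ant_step w ^^ i) c) = as ! i"
    using assms
  proof (induction as arbitrary: c i)
    case (Cons a as)
    show ?case
    proof (cases i)
      case (Suc j)
      then show ?thesis using Cons.IH[of "ant_step w c" j] Cons.prems by (simp add: funpow_swap1)
    qed (use Cons.prems in auto)
  qed simp
  then show "position ((ant_step w ^^ i) c) \<in> S" "w ! symbol_read ((ant_step w ^^ i) c) = as ! i"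
    by auto
qed

section \<open>Circling a block of four cells\<close>

abbreviation (input) rule_word :: "nat \<Rightarrow> letter list" where
  "rule_word k \<equiv> replicate (2 * k) L @ [R]"

lemma rule_word_nth: "n \<le> 2 * k \<Longrightarrow> rule_word k ! n = (if n = 2 * k then R else L)"
  by (auto simp: nth_append)

text \<open>In order of visit, the cells of four successive left turns from \<open>p\<close> with
  direction \<open>d\<close>.\<close>

definition block :: "vec \<Rightarrow> vec \<Rightarrow> vec set" where
  "block p d = {p, p + ccw d, p + ccw d - d, p - d}"

definition bump :: "vec set \<Rightarrow> nat \<Rightarrow> (vec \<Rightarrow> nat) \<Rightarrow> vec \<Rightarrow> nat" where
  "bump B m C z = (if z \<in> B then C z + m else C z)"

text \<open>With \<open>run_right\<close>, this lets the simplifier execute a run. The reduction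
  modulo \<open>2k + 1\<close> vanishes below \<open>2k\<close> and resets the cell at
  \<open>2k\<close>.\<close>

lemma run_left:
  assumes "C p < 2 * k" "p \<in> S"
  shows "run (rule_word k) S (L # as) (C, p, d) c' \<longleftrightarrow>
    run (rule_word k) S as (C(p := C p + 1), p + ccw d, ccw d) c'"
  using assms rule_word_nth[of "C p" k] by (simp add: symbol_read_def Let_def del: fun_upd_apply)

lemma run_right:
  assumes "C p = 2 * k" "p \<in> S"
  shows "run (rule_word k) S (R # as) (C, p, d) c' \<longleftrightarrow> run (rule_word k) S as (C(p := 0), p + cw d, cw d) c'"
  using assms rule_word_nth[of "C p" k] by (simp add: symbol_read_def Let_def del: fun_upd_apply)

text \<open>A nonzero \<open>d\<close> makes the four cells distinct, so each is read exactly
  once.\<close>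

lemma run_block_once:
  assumes "d \<noteq> 0" "block p d \<subseteq> S" "\<And>z. z \<in> block p d \<Longrightarrow> C z < 2 * k"
  shows "run (rule_word k) S [L, L, L, L] (C, p, d) (bump (block p d) 1 C, p, d)"
proof -
  obtain x y a b where [simp]: "p = (x, y)" "d = (a, b)"
    by (cases p, cases d)
  have "a \<noteq> 0 \<or> b \<noteq> 0" using assms(1) by (auto simp: zero_prod_def)
  then have ne: "(x - b, y + a) \<noteq> (x, y)" "(x - b - a, y + a - b) \<noteq> (x, y)"
    "(x - b - a, y + a - b) \<noteq> (x - b, y + a)" "(x - a, y - b) \<noteq> (x, y)"
    "(x - a, y - b) \<noteq> (x - b, y + a)" "(x - a, y - b) \<noteq> (x - b - a, y + a - b)"
    by auto
  have B: "block p d = {(x, y), (x - b, y + a), (x - b - a, y + a - b), (x - a, y - b)}"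
    by (simp add: block_def)
  have "C (x, y) < 2 * k" "C (x - b, y + a) < 2 * k" "C (x - b - a, y + a - b) < 2 * k"
    "C (x - a, y - b) < 2 * k" "(x, y) \<in> S" "(x - b, y + a) \<in> S" "(x - b - a, y + a - b) \<in> S"
    "(x - a, y - b) \<in> S"
    using assms(2,3) unfolding B by auto
  moreover have "bump (block p d) 1 C = C((x, y) := C (x, y) + 1, (x - b, y + a) := C (x - b, y + a) + 1,
      (x - b - a, y + a - b) := C (x - b - a, y + a - b) + 1, (x - a, y - b) := C (x - a, y - b) + 1)"
    unfolding B bump_def using ne by (intro ext) auto
  ultimately show ?thesis
    using ne by (simp add: run_left fun_upd_other fun_upd_same del: fun_upd_apply run.simps(2))
qed

lemma run_block:
  assumes "d \<noteq> 0" "block p d \<subseteq> S" "\<And>z. z \<in> block p d \<Longrightarrow> C z + m \<le> 2 * k"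
  shows "run (rule_word k) S (replicate (4 * m) L) (C, p, d) (bump (block p d) m C, p, d)"
  using assms(3)
proof (induction m arbitrary: C)
  case 0
  have "bump (block p d) 0 C = C" by (auto simp: bump_def)
  then show ?case by simp
next
  case (Suc m)
  have "replicate (4 * Suc m) L = [L, L, L, L] @ replicate (4 * m) L"
    by (simp add: numeral_eq_Suc)
  moreover have "run (rule_word k) S [L, L, L, L] (C, p, d) (bump (block p d) 1 C, p, d)"
    using Suc.prems by (intro run_block_once assms(1,2)) fastforce
  moreover have "run (rule_word k) S (replicate (4 * m) L) (bump (block p d) 1 C, p, d)
      (bump (block p d) m (bump (block p d) 1 C), p, d)"
    using Suc.prems by (intro Suc.IH) (fastforce simp: bump_def)
  moreover have "bump (block p d) m (bump (block p d) 1 C) = bump (block p d) (Suc m) C"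
    by (auto simp: bump_def)
  ultimately show ?case by (metis run_append)
qed

section \<open>One round from a pattern to the next\<close>

text \<open>The values are tuned so that \<open>m\<close> circuits bring \<open>(0, -1)\<close> to
  \<open>2k\<close>, and \<open>m - 1\<close> circuits bring \<open>(-1, -1)\<close> to
  \<open>2k\<close>.\<close>

definition pat :: "nat \<Rightarrow> nat \<Rightarrow> vec \<Rightarrow> nat" where
  "pat k m z =
    (if z = (0, -1) \<or> z = (0, -2) then 2 * k - m
     else if z = (-1, -1) then 2 * k - m + 1
     else if z = (-1, -2) then 2 * k - m - 1
     else 0)"

text \<open>The union of the three blocks circled in one round, relative to the ant at its
  start.\<close>

definition cells :: "vec set" where
  "cells = {(0, 0), (0, 1), (-1, 1), (-1, 0), (0, -1), (1, -1), (1, 0), (-1, -1), (-1, -2), (0, -2)}"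

text \<open>Relative to the ant, no cell \<open>z\<close> with \<open>fst z + snd z \<ge> 2\<close> has been visited yet.\<close>

definition ready :: "nat \<Rightarrow> nat \<Rightarrow> vec \<Rightarrow> (vec \<Rightarrow> nat) \<Rightarrow> bool" where
  "ready k m p C \<longleftrightarrow> (\<forall>z. z \<in> cells \<or> fst z + snd z \<ge> 2 \<longrightarrow> C (p + z) = pat k m z)"

definition turns :: "nat \<Rightarrow> nat \<Rightarrow> letter list" where
  "turns k m = replicate (4 * (2 * k)) L @ R # replicate (4 * m) L @ R #
     replicate (4 * (m - 1)) L @ [R, R, L, R]"

lemma length_turns: "0 < m \<Longrightarrow> length (turns k m) = 8 * k + 8 * m + 2"
  by (simp add: turns_def)

text \<open>Consecutive blocks share a corner, which the right turn between them resets to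
  \<open>0\<close>. Afterwards \<open>(x + 1, y)\<close> and \<open>(x + 1, y - 1)\<close> hold
  \<open>m\<close>, the corner \<open>(x, y)\<close> holds \<open>m + 1\<close> and the corner
  \<open>(x, y - 1)\<close> holds \<open>m - 1\<close>: this is the pattern for
  \<open>2k - m\<close> seen from \<open>p + (1, 1)\<close>.\<close>

lemma run_turns:
  assumes "0 < m" "m < 2 * k" "ready k m p C"
  shows "\<exists>C'. run (rule_word k) ((+) p ` cells) (turns k m) (C, p, (1, 0)) (C', p + (1, 1), (1, 0)) \<and>
    ready k (2 * k - m) (p + (1, 1)) C'"
proof -
  obtain x y where p: "p = (x, y)" by (cases p)
  let ?S = "(+) p ` cells"
  have S: "?S = {(x, y), (x, y + 1), (x - 1, y + 1), (x - 1, y), (x, y - 1), (x + 1, y - 1),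
      (x + 1, y), (x - 1, y - 1), (x - 1, y - 2), (x, y - 2)}"
    by (simp add: p cells_def)
  have C: "C (x, y) = 0" "C (x, y + 1) = 0" "C (x - 1, y + 1) = 0" "C (x - 1, y) = 0"
    "C (x, y - 1) = 2 * k - m" "C (x + 1, y - 1) = 0" "C (x + 1, y) = 0"
    "C (x - 1, y - 1) = 2 * k - m + 1" "C (x - 1, y - 2) = 2 * k - m - 1"
    "C (x, y - 2) = 2 * k - m"
  proof -
    have "\<forall>z\<in>cells. C (p + z) = pat k m z" using assms(3) unfolding ready_def by blast
    then show "C (x, y) = 0" "C (x, y + 1) = 0" "C (x - 1, y + 1) = 0" "C (x - 1, y) = 0"
      "C (x, y - 1) = 2 * k - m" "C (x + 1, y - 1) = 0" "C (x + 1, y) = 0"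
      "C (x - 1, y - 1) = 2 * k - m + 1" "C (x - 1, y - 2) = 2 * k - m - 1"
      "C (x, y - 2) = 2 * k - m"
      by (simp_all add: cells_def pat_def p)
  qed
  have far: "C (u, v) = 0" if "u + v \<ge> x + y + 2" for u v
  proof -
    have "C (p + (u - x, v - y)) = pat k m (u - x, v - y)"
      using assms(3) that unfolding ready_def by auto
    then show ?thesis using that by (auto simp: p pat_def split: if_splits)
  qed
  define B1 B2 B3 where
    "B1 = block (x, y) (1, 0)" and "B2 = block (x, y - 1) (0, -1)" and
    "B3 = block (x - 1, y - 1) (-1, 0)"
  note B = B1_def B2_def B3_def
  have B1: "B1 = {(x, y), (x, y + 1), (x - 1, y + 1), (x - 1, y)}"
    and B2: "B2 = {(x, y - 1), (x + 1, y - 1), (x + 1, y), (x, y)}"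
    and B3: "B3 = {(x - 1, y - 1), (x - 1, y - 2), (x, y - 2), (x, y - 1)}"
    by (simp_all add: B block_def)
  define C1 C2 C3 where
    "C1 = bump B1 (2 * k) C" and "C2 = bump B2 m (C1((x, y) := 0))" and
    "C3 = bump B3 (m - 1) (C2((x, y - 1) := 0))"
  \<comment> \<open>The last turns R, R, L, R happen at these four cells in this order.\<close>
  define C' where
    "C' = C3((x - 1, y - 1) := 0, (x - 1, y) := 0, (x, y) := m + 1, (x, y + 1) := 0)"
  have r1: "run (rule_word k) ?S (replicate (4 * (2 * k)) L) (C, (x, y), (1, 0)) (C1, (x, y), (1, 0))"
    unfolding C1_def B1_def
    by (rule run_block) (use B1 S C in \<open>auto simp: B zero_prod_def\<close>)
  have r2: "run (rule_word k) ?S (replicate (4 * m) L) (C1((x, y) := 0), (x, y - 1), (0, -1))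
      (C2, (x, y - 1), (0, -1))"
    unfolding C2_def B2_def
  proof (rule run_block)
    fix z assume "z \<in> block (x, y - 1) (0, - 1)"
    then have "z \<in> B2" by (simp add: B)
    then show "(C1((x, y) := 0)) z + m \<le> 2 * k"
      unfolding B2 using assms(2) by (auto simp: C1_def bump_def B1 C)
  qed (use B2 S in \<open>auto simp: B zero_prod_def\<close>)
  have r3: "run (rule_word k) ?S (replicate (4 * (m - 1)) L) (C2((x, y - 1) := 0), (x - 1, y - 1), (-1, 0))
      (C3, (x - 1, y - 1), (-1, 0))"
    unfolding C3_def B3_def
  proof (rule run_block)
    fix z assume "z \<in> block (x - 1, y - 1) (-1, 0)"
    then have "z \<in> B3" by (simp add: B)
    \<comment> \<open>Equality holds at \<open>(x - 1, y - 1)\<close>, where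
      \<open>2k - m + 1\<close> meets \<open>m - 1\<close> circuits; the shared corner starts again
      from \<open>0\<close>.\<close>
    then show "(C2((x, y - 1) := 0)) z + (m - 1) \<le> 2 * k"
      unfolding B3 using assms(1,2) by (auto simp: C1_def C2_def bump_def B1 B2 C)
  qed (use B3 S in \<open>auto simp: B zero_prod_def\<close>)
  have C12: "C1 (x, y) = 2 * k" "C2 (x, y - 1) = 2 * k"
    using assms(2) by (simp_all add: C1_def C2_def bump_def B1 B2 C)
  have C3: "C3 (x - 1, y - 1) = 2 * k" "C3 (x - 1, y) = 2 * k" "C3 (x, y) = m"
      "C3 (x, y + 1) = 2 * k"
    using assms(1,2) by (simp_all add: C1_def C2_def C3_def bump_def B1 B2 B3 C)
  have S12: "(x, y) \<in> ?S" "(x, y - 1) \<in> ?S"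
    unfolding S by simp_all
  let ?c' = "(C', (x + 1, y + 1), (1, 0))"
  \<comment> \<open>The cells \<open>(x - 1, y)\<close> and \<open>(x, y + 1)\<close> still hold
    \<open>2k\<close> from the first block; the only left turn is at \<open>(x, y)\<close>, which
    holds \<open>m < 2k\<close>.\<close>
  have "run (rule_word k) ?S [R, R, L, R] (C3, (x - 1, y - 1), (-1, 0)) ?c'"
    unfolding C'_def using assms(2)
    by (simp add: run_left run_right C3 S fun_upd_other fun_upd_same del: fun_upd_apply run.simps(2))
  then have "run (rule_word k) ?S (replicate (4 * (m - 1)) L @ [R, R, L, R])
      (C2((x, y - 1) := 0), (x - 1, y - 1), (-1, 0)) ?c'"
    unfolding run_append using r3 by blast
  then have "run (rule_word k) ?S (R # replicate (4 * (m - 1)) L @ [R, R, L, R])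
      (C2, (x, y - 1), (0, -1)) ?c'"
    unfolding run_right[where C = C2, OF C12(2) S12(2)] by simp
  then have "run (rule_word k) ?S (replicate (4 * m) L @ R # replicate (4 * (m - 1)) L @ [R, R, L, R])
      (C1((x, y) := 0), (x, y - 1), (0, -1)) ?c'"
    unfolding run_append[where as = "replicate (4 * m) L"] using r2 by blast
  then have "run (rule_word k) ?S
      (R # replicate (4 * m) L @ R # replicate (4 * (m - 1)) L @ [R, R, L, R]) (C1, (x, y), (1, 0)) ?c'"
    unfolding run_right[where C = C1, OF C12(1) S12(1)] by simp
  then have "run (rule_word k) ?S (turns k m) (C, (x, y), (1, 0)) ?c'"
    unfolding turns_def run_append[where as = "replicate (4 * (2 * k)) L"] using r1 by blast
  then have "run (rule_word k) ?S (turns k m) (C, p, (1, 0)) (C', p + (1, 1), (1, 0))"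
    by (simp add: p)
  moreover have "ready k (2 * k - m) (p + (1, 1)) C'"
    unfolding ready_def
  proof (intro allI impI)
    fix z :: vec
    assume z: "z \<in> cells \<or> fst z + snd z \<ge> 2"
    have C'_eq: "C' (x, y) = m + 1" "C' (x, y - 1) = m - 1" "C' (x + 1, y - 1) = m"
      "C' (x + 1, y) = m" "C' (x, y + 1) = 0"
      using assms by (simp_all add: C'_def C1_def C2_def C3_def bump_def B1 B2 B3 C)
    have rest: "C' q = C q" if "q \<notin> ?S" for q
      using that unfolding S by (simp add: C'_def C1_def C2_def C3_def bump_def B1 B2 B3)
    show "C' (p + (1, 1) + z) = pat k (2 * k - m) z"
    proof (cases "p + (1, 1) + z \<in> ?S")
      case True
      then obtain c where "c \<in> cells" "p + (1, 1) + z = p + c"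
        by blast
      moreover from this have "z = c - (1, 1)"
        by (simp add: add.assoc eq_diff_eq add.commute)
      ultimately show ?thesis
        using z assms(1,2) unfolding cells_def by (auto simp: pat_def p C'_eq)
    next
      case False
      \<comment> \<open>Shifted by \<open>(1, 1)\<close>, the members of \<open>cells\<close> with
        negative coordinate sum all fall on cells of this round. Any other \<open>z\<close> in
        question therefore lies in the unvisited half plane seen from \<open>p\<close>.\<close>
      have "fst z + snd z \<ge> 0"
      proof (rule ccontr)
        assume "\<not> fst z + snd z \<ge> 0"
        then have "z \<in> {(-1, 0), (0, -1), (-1, -1), (-1, -2), (0, -2)}"
          using z unfolding cells_def by auto
        then have "p + (1, 1) + z \<in> ?S"
          unfolding S by (auto simp: p)
        then show False using False by contradiction
      qed
      then have "C (p + (1, 1) + z) = 0" "pat k (2 * k - m) z = 0"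
        using far[of "x + 1 + fst z" "y + 1 + snd z"] by (auto simp: p pat_def plus_prod_def)
      then show ?thesis
        using rest[OF False] by simp
    qed
  qed
  ultimately show ?thesis by blast
qed

section \<open>Closing up the two highways\<close>

text \<open>The first condition on \<open>z \<in> S\<close> says that \<open>ready\<close> determines the symbol there.\<close>

definition highway_data :: "nat \<Rightarrow> nat \<Rightarrow> vec set \<Rightarrow> letter list \<Rightarrow> vec \<Rightarrow> bool" where
  "highway_data k m S ts v \<longleftrightarrow> ts \<noteq> [] \<and> finite S \<and> cells \<subseteq> S \<and>
     (\<forall>z\<in>S. (z \<in> cells \<or> fst z + snd z \<ge> 2) \<and> (z + v \<notin> S \<longrightarrow> pat k m z = 0)) \<and>
     (\<forall>p C. ready k m p C \<longrightarrow>
        (\<exists>C'. run (rule_word k) ((+) p ` S) ts (C, p, (1, 0)) (C', p + v, (1, 0)) \<and>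
              ready k m (p + v) C'))"

lemma finite_cells: "finite cells"
  by (simp add: cells_def)

lemma turns_not_Nil: "turns k m \<noteq> []"
  by (simp add: turns_def)

lemma highway_data_fundamental:
  assumes "k > 0"
  shows "highway_data k k cells (turns k k) (1, 1)"
proof -
  have eq: "2 * k - k = k" and less: "k < 2 * k"
    using assms by simp_all
  have "\<forall>z\<in>cells. z + (1, 1) \<notin> cells \<longrightarrow> pat k k z = 0"
    by (simp add: cells_def pat_def)
  then show ?thesis
    unfolding highway_data_def
    using run_turns[OF assms less, unfolded eq] finite_cells turns_not_Nil by blast
qed

text \<open>\<open>k > 1\<close> makes \<open>k - 1\<close> positive, as the second round requires.
  That round takes place on the copy of \<open>cells\<close> shifted by
  \<open>(1, 1)\<close>.\<close>

lemma highway_data_harmonic: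
  assumes "k > 1"
  shows "highway_data k (k + 1) (cells \<union> (+) (1, 1) ` cells) (turns k (k + 1) @ turns k (k - 1)) (2, 2)"
proof -
  let ?S = "cells \<union> (+) (1, 1) ` cells"
  have "\<exists>C'. run (rule_word k) ((+) p ` ?S) (turns k (k + 1) @ turns k (k - 1))
      (C, p, (1, 0)) (C', p + (2, 2), (1, 0)) \<and> ready k (k + 1) (p + (2, 2)) C'"
    if C: "ready k (k + 1) p C" for p C
  proof -
    have m: "2 * k - (k + 1) = k - 1" "2 * k - (k - 1) = k + 1"
      using assms by simp_all
    have pos: "0 < k - 1" "k - 1 < 2 * k"
      using assms by simp_all
    have p: "p + (1, 1) + (1, 1) = p + (2, 2)"
      by (cases p) simp
    obtain C1 where C1: "run (rule_word k) ((+) p ` cells) (turns k (k + 1)) (C, p, (1, 0))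
        (C1, p + (1, 1), (1, 0))" "ready k (k - 1) (p + (1, 1)) C1"
      using run_turns[OF _ _ C, unfolded m(1)] assms by fastforce
    obtain C2 where C2: "run (rule_word k) ((+) (p + (1, 1)) ` cells) (turns k (k - 1))
        (C1, p + (1, 1), (1, 0)) (C2, p + (2, 2), (1, 0))" "ready k (k + 1) (p + (2, 2)) C2"
      using run_turns[OF pos C1(2), unfolded m(2) p] by blast
    have "(+) p ` cells \<subseteq> (+) p ` ?S" "(+) (p + (1, 1)) ` cells \<subseteq> (+) p ` ?S"
      unfolding image_Un image_image add.assoc by simp_all
    then have "run (rule_word k) ((+) p ` ?S) (turns k (k + 1)) (C, p, (1, 0)) (C1, p + (1, 1), (1, 0))"
      "run (rule_word k) ((+) p ` ?S) (turns k (k - 1)) (C1, p + (1, 1), (1, 0)) (C2, p + (2, 2), (1, 0))"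
      using C1(1) C2(1) by (simp_all only: run_mono)
    then show ?thesis
      unfolding run_append using C2(2) by blast
  qed
  moreover have "\<forall>z\<in>?S. (z \<in> cells \<or> fst z + snd z \<ge> 2) \<and>
      (z + (2, 2) \<notin> ?S \<longrightarrow> pat k (k + 1) z = 0)"
    by (simp add: cells_def pat_def)
  moreover have "finite ?S" "cells \<subseteq> ?S"
    using finite_cells by auto
  ultimately show ?thesis
    unfolding highway_data_def using turns_not_Nil by blast
qed

text \<open>\<open>ready\<close> at \<open>v\<close> says that the symbol at \<open>z + v\<close> is
  again \<open>pat k m z\<close>, which is the periodicity required of a highway.\<close>

lemma is_highway_highway_data:
  assumes "highway_data k m S ts v" "0 < m" "m < 2 * k"
  shows "is_highway (rule_word k) (length ts) v (S, pat k m, 0, (1, 0))"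
proof -
  have "ready k m 0 (pat k m)"
    by (simp add: ready_def)
  then obtain C' where C': "run (rule_word k) S ts (pat k m, 0, (1, 0)) (C', v, (1, 0))" "ready k m v C'"
    using assms(1) unfolding highway_data_def by fastforce
  \<comment> \<open>Positivity of \<open>m\<close> keeps \<open>2k - m + 1\<close> a legal
    symbol.\<close>
  have "pat k m z < length (rule_word k)" for z
    using assms(2,3) by (auto simp: pat_def)
  moreover have "0 \<in> S"
    using assms(1) by (auto simp: highway_data_def cells_def zero_prod_def)
  ultimately show ?thesis
    using assms(1) run_funpow[OF C'(1)] run_nth(1)[OF C'(1)] C'(2)
    by (auto simp: highway_data_def ready_def directions_def add.commute[of _ v])
qed

section \<open>Telling the two highways apart\<close>

text \<open>After each period the picture is \<open>ready\<close> again, so the turns repeat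
  \<open>ts\<close> forever.\<close>

lemma turn_in_evolution:
  assumes "highway_data k m S ts v" "i < length ts"
  shows "rule_word k ! symbol_read (evolution (rule_word k) (S, pat k m, 0, (1, 0)) (j * length ts + i)) = ts ! i"
proof -
  have "pat k m z = 0" if "z \<notin> S" for z
    using that assms(1) by (auto simp: highway_data_def cells_def pat_def)
  then have pat: "(\<lambda>z. if z \<in> S then pat k m z else 0) = pat k m"
    by force
  have "\<exists>C p. (ant_step (rule_word k) ^^ (j * length ts)) (pat k m, 0, (1, 0)) = (C, p, (1, 0)) \<and> ready k m p C"
  proof (induction j)
    case 0
    show ?case by (simp add: ready_def)
  next
    case (Suc j)
    then obtain C p where C: "(ant_step (rule_word k) ^^ (j * length ts)) (pat k m, 0, (1, 0)) = (C, p, (1, 0))"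
      "ready k m p C" by auto
    then obtain C' where "run (rule_word k) ((+) p ` S) ts (C, p, (1, 0)) (C', p + v, (1, 0))"
      "ready k m (p + v) C'"
      using assms(1) unfolding highway_data_def by blast
    then show ?case
      using C(1) run_funpow by (auto simp: funpow_add)
  qed
  then obtain C p where C: "(ant_step (rule_word k) ^^ (j * length ts)) (pat k m, 0, (1, 0)) = (C, p, (1, 0))"
    "ready k m p C" by auto
  then obtain C' where "run (rule_word k) ((+) p ` S) ts (C, p, (1, 0)) C'"
    using assms(1) unfolding highway_data_def by blast
  from run_nth(2)[OF this assms(2)] show ?thesis
    using C(1) by (simp only: evolution.simps pat add.commute[of _ i] funpow_add o_apply)
qed

lemma right_turns_fundamental:
  assumes "turns k k ! i = R" "i < 16 * k + 2" "k > 0"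
  shows "i \<in> {8 * k, 12 * k + 1, 16 * k - 2, 16 * k - 1, 16 * k + 1}"
proof -
  consider "i < 8 * k" | "i = 8 * k" | "8 * k < i" "i < 12 * k + 1" | "i = 12 * k + 1"
    | "12 * k + 1 < i" "i < 16 * k - 2" | "i = 16 * k - 2" | "i = 16 * k - 1" | "i = 16 * k" | "i = 16 * k + 1"
    using assms(2) by linarith
  then show ?thesis
    using assms(1,3) by cases (auto simp: turns_def nth_append nth_Cons' split: if_splits)
qed

text \<open>The first two right turns enclose \<open>4(k + 1)\<close> left turns, hence the gap
  \<open>4k + 5\<close>.\<close>

lemma right_turns_harmonic:
  "turns k (k + 1) ! (8 * k) = R" "turns k (k + 1) ! (8 * k + (4 * k + 5)) = R"
  by (simp_all add: turns_def nth_append nth_Cons')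

theorem mainTheorem2:
  fixes k :: nat
  assumes "k > 1"
  defines "w \<equiv> replicate (2 * k) L @ [R]"
  shows "\<exists>H H' a b a' b'.
           is_highway w (16 * k + 2) (a, b) H \<and> a \<in> {1, -1} \<and> b \<in> {1, -1} \<and>
           is_highway w (32 * k + 4) (a', b') H' \<and> a' \<in> {2, -2} \<and> b' \<in> {2, -2} \<and>
           \<not> same_highway w H H'"
proof -
  let ?T = "cells \<union> (+) (1, 1) ` cells" and ?us = "turns k (k + 1) @ turns k (k - 1)"
  let ?H = "(cells, pat k k, 0, (1, 0))" and ?H' = "(?T, pat k (k + 1), 0, (1, 0))"
  have bounds: "0 < k" "k < 2 * k" "0 < k + 1" "k + 1 < 2 * k"
    using assms(1) by simp_all
  note H = highway_data_fundamental[OF bounds(1)] and H' = highway_data_harmonic[OF assms(1)]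
  have len: "length (turns k k) = 16 * k + 2" and len': "length ?us = 32 * k + 4"
    using assms(1) by (simp_all add: length_turns)
  have "\<not> same_highway w ?H ?H'"
  proof
    assume "same_highway w ?H ?H'"
    then obtain s t where eq: "\<And>n. symbol_read (evolution w ?H' (t + n)) = symbol_read (evolution w ?H (s + n))"
      unfolding same_highway_def Let_def by blast
    \<comment> \<open>Chosen so that time \<open>t + n\<close> is the first right turn of a harmonic
      period; the subtraction does not truncate.\<close>
    define n where "n = t * length ?us - t + 8 * k"
    have n: "t + n = t * length ?us + 8 * k"
      unfolding n_def len' by (simp add: algebra_simps)
    have nth: "?us ! (8 * k) = R" "?us ! (8 * k + (4 * k + 5)) = R"
      using right_turns_harmonic[of k] by (simp_all add: nth_append length_turns)
    have right: "turns k k ! (q mod (16 * k + 2)) = w ! symbol_read (evolution w ?H q)" for q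
      using turn_in_evolution[OF H, of "q mod (16 * k + 2)" "q div (16 * k + 2)"]
      unfolding len w_def div_mult_mod_eq by simp
    have shift: "turns k k ! ((s + n + i) mod (16 * k + 2)) = ?us ! (8 * k + i)"
      if "8 * k + i < length ?us" for i
    proof -
      have "t + (n + i) = t * length ?us + (8 * k + i)"
        using n by simp
      then show ?thesis
        using turn_in_evolution[OF H' that, of t] eq[of "n + i"]
        unfolding right w_def by (simp only: add.assoc)
    qed
    have R1: "turns k k ! ((s + n) mod (16 * k + 2)) = R"
      using shift[of 0] nth(1) unfolding len' by simp
    have R2: "turns k k ! ((s + n + (4 * k + 5)) mod (16 * k + 2)) = R"
      using shift[of "4 * k + 5"] assms(1) unfolding nth(2) len' by simp
    define e where "e = (s + n) mod (16 * k + 2)"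
    have "e < 16 * k + 2" unfolding e_def by simp
    moreover have "(s + n + (4 * k + 5)) mod (16 * k + 2) = (e + (4 * k + 5)) mod (16 * k + 2)"
      unfolding e_def by (simp add: mod_add_left_eq)
    \<comment> \<open>Both summands are below the period, so the sum wraps around at most
      once.\<close>
    moreover have "\<dots> = (if e + (4 * k + 5) < 16 * k + 2 then e + (4 * k + 5)
        else e + (4 * k + 5) - (16 * k + 2))"
      using calculation(1) assms(1) by (simp add: mod_if)
    \<comment> \<open>No two right turns of the fundamental word are \<open>4k + 5\<close> apart
      modulo \<open>16k + 2\<close>; the distance \<open>8k + 1\<close> does occur and would equal
      it only for \<open>k = 1\<close>.\<close>
    ultimately show False
      using right_turns_fundamental[OF R1] right_turns_fundamental[OF R2] assms(1)
      unfolding e_def[symmetric] by (auto split: if_splits)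
  qed
  moreover have "is_highway w (16 * k + 2) (1, 1) ?H"
    using is_highway_highway_data[OF H bounds(1,2)] unfolding w_def len .
  moreover have "is_highway w (32 * k + 4) (2, 2) ?H'"
    using is_highway_highway_data[OF H' bounds(3,4)] unfolding w_def len' .
  ultimately show ?thesis by blast
qed

end
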